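(* Let $\mu>0$, let $f\in\mathcal{S}_{\mu}(\mathbb{R}^{d_1})$, $g\in\mathcal{F}(\mathbb{R}^{d_2})$, $F\in\mathbb{R}^{d_2\times d_1}$, let $s>0$ with $s^2\in(0,\|F\|^{-2})$, and let $c\in(0,2\mu)$. Let $(x^{\star},y^{\star})$ be a saddle point of $\Phi(x,y)=f(x)+\langle Fx,y\rangle-g^{\star}(y)$. Let $\{(x_k,y_k)\}_{k\ge 0}$ be generated from arbitrary $(x_0,y_0)\in\mathbb{R}^{d_1}\times\mathbb{R}^{d_2}$ by the PDHG algorithm with $\theta_k=1$ for all $k\ge0$ and step sizes $$\tau_k=\frac{1}{c(k+1)},\qquad \sigma_k=cs^2(k+1)\qquad(k\ge 0).$$ For $k\ge 0$ define $$\mathcal{E}(k)=\frac{1}{2\tau_k}\|x_k-x^{\star}\|^2+\frac{1}{2\sigma_k}\|y_k-y^{\star}\|^2-\langle F(x_k-x^{\star}),y_k-y^{\star}\rangle,$$ and let $$\alpha=\min\left(\frac{2\mu-c}{s+c},\ \frac{1}{1+cs\|F\|^2}\right).$$ Then for every $k\ge 0$, $$\mathcal{E}(k)\le\frac{(1+\alpha)\,(k+1)!}{(k+1+\alpha)!}\,\mathcal{E}(0).$$ Furthermore, the sequence $\{x_k\}_{k\ge 0}$ converges to $x^{\star}$ at the rate $$\|x_k-x^{\star}\|^2\le\frac{1+s\|F\|}{1-s\|F\|}\cdot\frac{(1+\alpha)\cdot k!}{(k+1+\alpha)!}\left(\|x_0-x^{\star}\|^2+\frac{1}{c^2s^2}\|y_0-y^{\star}\|^2\right)\qquad\text{for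 all }k\ge 0.$$
   Context: Notation. $\|\cdot\|$ is the Euclidean norm on vectors and the induced operator (spectral) norm on matrices. For a non-integer real $z>0$, $z!$ means $\Gamma(z+1)$. $\mathcal{F}(\mathbb{R}^d)$ is the class of proper, lower semi-continuous, convex functions $\mathbb{R}^d\to(-\infty,\infty]$. A vector $v$ is a subgradient of a convex $f$ at $x\in\mathrm{dom}(f)$ if $f(y)\ge f(x)+\langle v,y-x\rangle$ for all $y$; $\partial f(x)$ is the set of subgradients. $\mathcal{S}_{\mu}(\mathbb{R}^d)\subset\mathcal{F}(\mathbb{R}^d)$ is the class of $\mu$-strongly convex functions: $f(y)\ge f(x)+\langle v,y-x\rangle+\frac{\mu}{2}\|y-x\|^2$ for all $x,y$ and all $v\in\partial f(x)$. The conjugate of $g$ is $g^{\star}(y)=\sup_{x}(\langle y,x\rangle-g(x))$. A saddle point of $\Phi$ is a pair $(x^{\star},y^{\star})$ with $\Phi(x^{\star},y)\le\Phi(x^{\star},y^{\star})\le\Phi(x,y^{\star})$ for all $x\in\mathbb{R}^{d_1}$, $y\in\mathbb{R}^{d_2}$; for $\Phi(x,y)=f(x)+\langle Fx,y\rangle-g^{\star}(y)$ this is equivalent to $-F^{\top}y^{\star}\in\partial f(x^{\star})$ and $Fx^{\star}\in\partial g^{\star}(y^{\star})$. PDHG algorithm with parameters $\tau_k,\sigma_k>0$ and $\theta_k\in(0,1]$: for $k=0,1,2,\dots$, $$x_{k+1}=\operatorname{argmin}_{x\in\mathbb{R}^{d_1}}\Big\{f(x)+\langle Fx,y_k\rangle+\tfrac{1}{2\tau_k}\|x-x_k\|^2\Big\},$$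 $$\overline{x}_{k+1}=x_{k+1}+\theta_k(x_{k+1}-x_k),$$ $$y_{k+1}=\operatorname{argmax}_{y\in\mathbb{R}^{d_2}}\Big\{-g^{\star}(y)+\langle F\overline{x}_{k+1},y\rangle-\tfrac{1}{2\sigma_k}\|y-y_k\|^2\Big\}.$$ *)

theory Defs
  imports "HOL-Analysis.Analysis"
begin

definition proper :: "('a \<Rightarrow> ereal) \<Rightarrow> bool" where
  "proper f \<longleftrightarrow> (\<forall>x. f x \<noteq> - \<infinity>) \<and> (\<exists>x. f x \<noteq> \<infinity>)"

definition lower_semicontinuous :: "('a :: topological_space \<Rightarrow> ereal) \<Rightarrow> bool" where
  "lower_semicontinuous f \<longleftrightarrow> (\<forall>x. f x \<le> Liminf (at x) f)"

text \<open>
  The library's \<open>convex_on\<close> covers real-valued functions only. The right-hand side below is the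
  expected one as long as \<open>f\<close> never takes the value \<open>- \<infinity>\<close>; this definition is only used together
  with \<open>proper\<close>.
\<close>

definition convex_ereal :: "('a :: real_vector \<Rightarrow> ereal) \<Rightarrow> bool" where
  "convex_ereal f \<longleftrightarrow>
    (\<forall>x y. \<forall>t\<in>{0<..<1}.
      f ((1 - t) *\<^sub>R x + t *\<^sub>R y) \<le> ereal (1 - t) * f x + ereal t * f y)"

definition closed_convex_functions :: "('a :: real_normed_vector \<Rightarrow> ereal) set"  (\<open>\<F>\<close>) where
  "\<F> = {f. proper f \<and> lower_semicontinuous f \<and> convex_ereal f}"

definition effective_domain :: "('a \<Rightarrow> ereal) \<Rightarrow> 'a set" where
  "effective_domain f = {x. f x < \<infinity>}"

definition subdifferential :: "('a :: real_inner \<Rightarrow> ereal) \<Rightarrow> 'a \<Rightarrow> 'a set" where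
  "subdifferential f x =
    {v. x \<in> effective_domain f \<and> (\<forall>y. f x + ereal (v \<bullet> (y - x)) \<le> f y)}"

definition strongly_convex_functions :: "real \<Rightarrow> ('a :: real_inner \<Rightarrow> ereal) set"  (\<open>\<S>\<close>) where
  "\<S> \<mu> = {f \<in> \<F>. \<forall>x y. \<forall>v\<in>subdifferential f x.
    f x + ereal (v \<bullet> (y - x) + \<mu> / 2 * (norm (y - x))\<^sup>2) \<le> f y}"

definition conjugate :: "('a :: real_inner \<Rightarrow> ereal) \<Rightarrow> 'a \<Rightarrow> ereal" where
  "conjugate g y = (SUP x. ereal (y \<bullet> x) - g x)"

definition op_norm :: "real^'n^'m \<Rightarrow> real" where
  "op_norm F = onorm ((*v) F)"

text \<open>
  On type \<^typ>\<open>ereal\<close>, \<open>\<infinity> - \<infinity> = \<infinity>\<close>. This convention for \<open>\<Phi>(x, y)\<close> with \<open>f x = \<infinity>\<close> and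
  \<open>g\<^sup>\<star> y = \<infinity>\<close> has no influence on the saddle points: for proper \<open>f\<close> and \<open>g\<^sup>\<star>\<close>, a saddle point
  always has \<open>f x < \<infinity>\<close> and \<open>g\<^sup>\<star> y < \<infinity>\<close>.
\<close>

definition lagrangian ::
  "(real^'n \<Rightarrow> ereal) \<Rightarrow> (real^'m \<Rightarrow> ereal) \<Rightarrow> real^'n^'m \<Rightarrow> real^'n \<Rightarrow> real^'m \<Rightarrow> ereal" where
  "lagrangian f g F x y = f x + ereal ((F *v x) \<bullet> y) - conjugate g y"

definition saddle_point :: "('a \<Rightarrow> 'b \<Rightarrow> ereal) \<Rightarrow> 'a \<Rightarrow> 'b \<Rightarrow> bool" where
  "saddle_point \<Phi> xs ys \<longleftrightarrow> (\<forall>x y. \<Phi> xs y \<le> \<Phi> xs ys \<and> \<Phi> xs ys \<le> \<Phi> x ys)"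

text \<open>
  The predicate says that the two sequences satisfy the update rules. The argmin and the argmax are
  expressed by \<^const>\<open>is_arg_min\<close> and \<^const>\<open>is_arg_max\<close>, so the new iterates are minimizers and
  maximizers, not values chosen by \<open>SOME\<close>.
\<close>

definition pdhg ::
  "(real^'n \<Rightarrow> ereal) \<Rightarrow> (real^'m \<Rightarrow> ereal) \<Rightarrow> real^'n^'m \<Rightarrow>
   (nat \<Rightarrow> real) \<Rightarrow> (nat \<Rightarrow> real) \<Rightarrow> (nat \<Rightarrow> real) \<Rightarrow>
   (nat \<Rightarrow> real^'n) \<Rightarrow> (nat \<Rightarrow> real^'m) \<Rightarrow> bool" where
  "pdhg f g F \<tau> \<sigma> \<theta> x y \<longleftrightarrow>
    (\<forall>k.
      is_arg_min
        (\<lambda>u. f u + ereal ((F *v u) \<bullet> y k) + ereal (1 / (2 * \<tau> k) * (norm (u - x k))\<^sup>2))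
        (\<lambda>_. True) (x (Suc k)) \<and>
      (let xbar = x (Suc k) + \<theta> k *\<^sub>R (x (Suc k) - x k) in
       is_arg_max
        (\<lambda>v. - conjugate g v + ereal ((F *v xbar) \<bullet> v) - ereal (1 / (2 * \<sigma> k) * (norm (v - y k))\<^sup>2))
        (\<lambda>_. True) (y (Suc k))))"

definition energy ::
  "real^'n^'m \<Rightarrow> (nat \<Rightarrow> real) \<Rightarrow> (nat \<Rightarrow> real) \<Rightarrow> real^'n \<Rightarrow> real^'m \<Rightarrow>
   (nat \<Rightarrow> real^'n) \<Rightarrow> (nat \<Rightarrow> real^'m) \<Rightarrow> nat \<Rightarrow> real" where
  "energy F \<tau> \<sigma> xs ys x y k =
    1 / (2 * \<tau> k) * (norm (x k - xs))\<^sup>2 + 1 / (2 * \<sigma> k) * (norm (y k - ys))\<^sup>2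
    - (F *v (x k - xs)) \<bullet> (y k - ys)"

text \<open>
  The factorial \<open>z!\<close> of a non-integer \<open>z > 0\<close>; it agrees with \<^const>\<open>fact\<close> on natural numbers.
\<close>

definition real_fact :: "real \<Rightarrow> real" where
  "real_fact z = Gamma (z + 1)"

end

theory Submission
  imports Defs
begin

text \<open>
  The optimality conditions of the two proximal steps and of the saddle point, combined with strong
  monotonicity of \<open>\<partial>f\<close> and monotonicity of \<open>\<partial>g\<^sup>\<star>\<close>, show that from step \<open>k\<close> to \<open>k + 1\<close> the energy
  drops by at least a multiple of \<open>\<parallel>x\<^sub>k\<^sub>+\<^sub>1 - x\<^sup>\<star>\<parallel>\<^sup>2\<close> and \<open>\<parallel>y\<^sub>k\<^sub>+\<^sub>1 - y\<^sup>\<star>\<parallel>\<^sup>2\<close>: the first gain is what strong convexity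
  leaves after paying for the decrease of \<open>\<tau>\<close>, the second comes from the growth of \<open>\<sigma>\<close>. By
  Young's inequality these gains dominate \<open>\<alpha> / (k + 2)\<close> times the new energy, so
  \<open>(k + 2 + \<alpha>) E(k + 1) \<le> (k + 2) E(k)\<close>. Iterating produces the Gamma quotient; at \<open>k = 0\<close> it
  is \<open>1 / \<Gamma>(1 + \<alpha>) \<ge> 1\<close> by log-convexity of \<open>\<Gamma>\<close>.
\<close>

section \<open>Epigraphs, affine minorants and properness of the conjugate\<close>

lemma closed_epigraph:
  assumes "lower_semicontinuous f"
  shows "closed {p :: 'a :: topological_space \<times> real. f (fst p) \<le> ereal (snd p)}"
proof -
  have "\<exists>T. open T \<and> p \<in> T \<and> T \<subseteq> {p. ereal (snd p) < f (fst p)}"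
    if p: "ereal (snd p) < f (fst p)" for p :: "'a \<times> real"
  proof -
    obtain a b where ab: "p = (a, b)" by force
    obtain C where C: "b < C" "ereal C < f a"
      using p ereal_dense2[of "ereal b" "f a"] by (auto simp: ab)
    have "ereal C < Liminf (at a) f"
      using C(2) assms by (auto simp: lower_semicontinuous_def intro: less_le_trans)
    then have "\<forall>\<^sub>F u in at a. ereal C < f u"
      by (rule less_LiminfD)
    \<comment> \<open>The filter \<open>at a\<close> leaves out \<open>a\<close> itself;
      \<open>ereal C < f a\<close> supplies the missing point.\<close>
    then have "\<forall>\<^sub>F u in nhds a. ereal C < f u"
      using C(2) by (auto simp: eventually_at_filter elim: eventually_mono)
    then obtain S where S: "open S" "a \<in> S" "\<And>u. u \<in> S \<Longrightarrow> ereal C < f u"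
      by (auto simp: eventually_nhds)
    have "open (S \<times> {..<C})" "p \<in> S \<times> {..<C}"
      using S C by (auto simp: ab intro: open_Times)
    moreover have "S \<times> {..<C} \<subseteq> {p. ereal (snd p) < f (fst p)}"
      using S(3) by (auto intro: order.strict_trans[of _ "ereal C"])
    ultimately show ?thesis by blast
  qed
  then have "open {p :: 'a \<times> real. ereal (snd p) < f (fst p)}"
    by (subst open_subopen) auto
  moreover have "{p :: 'a \<times> real. f (fst p) \<le> ereal (snd p)} = - {p. ereal (snd p) < f (fst p)}"
    by auto
  ultimately show ?thesis by (simp add: closed_def)
qed

lemma convex_epigraph:
  assumes "convex_ereal f"
  shows "convex {p :: 'a :: real_vector \<times> real. f (fst p) \<le> ereal (snd p)}"
  unfolding convex_alt
proof (intro ballI allI impI)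
  fix p q :: "'a \<times> real" and t :: real
  assume p: "p \<in> {p. f (fst p) \<le> ereal (snd p)}" and q: "q \<in> {p. f (fst p) \<le> ereal (snd p)}"
    and t: "0 \<le> t \<and> t \<le> 1"
  show "(1 - t) *\<^sub>R p + t *\<^sub>R q \<in> {p. f (fst p) \<le> ereal (snd p)}"
  proof (cases "t = 0 \<or> t = 1")
    case True
    then show ?thesis using p q by auto
  next
    case False
    then have "t \<in> {0<..<1}" using t by auto
    then have "f ((1 - t) *\<^sub>R fst p + t *\<^sub>R fst q) \<le> ereal (1 - t) * f (fst p) + ereal t * f (fst q)"
      using assms by (auto simp: convex_ereal_def)
    also have "\<dots> \<le> ereal (1 - t) * ereal (snd p) + ereal t * ereal (snd q)"
      using p q t by (intro add_mono ereal_mult_left_mono) auto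
    finally show ?thesis by simp
  qed
qed

text \<open>A point just below the graph is strictly separated from the closed convex epigraph. The
  separating hyperplane is not vertical, so it is the graph of an affine function below
  \<open>g\<close>.\<close>

lemma closed_convex_affine_minorant:
  fixes g :: "'a :: euclidean_space \<Rightarrow> ereal"
  assumes "g \<in> \<F>"
  obtains v d where "\<And>x. ereal (v \<bullet> x - d) \<le> g x"
proof -
  have g: "proper g" "lower_semicontinuous g" "convex_ereal g"
    using assms by (auto simp: closed_convex_functions_def)
  obtain x0 where "g x0 \<noteq> \<infinity>" using g(1) by (auto simp: proper_def)
  moreover have "g x0 \<noteq> - \<infinity>" using g(1) by (auto simp: proper_def)
  ultimately obtain r0 where r0: "g x0 = ereal r0" by (cases "g x0") auto
  define epi where "epi = {p. g (fst p) \<le> ereal (snd p)}"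
  have "(x0, r0 - 1) \<notin> epi" by (simp add: epi_def r0)
  moreover have "convex epi" "closed epi"
    unfolding epi_def using convex_epigraph[OF g(3)] closed_epigraph[OF g(2)] by auto
  ultimately obtain ab d where sep: "ab \<bullet> (x0, r0 - 1) < d" "\<And>p. p \<in> epi \<Longrightarrow> ab \<bullet> p > d"
    by (metis separating_hyperplane_closed_point)
  obtain a b where ab: "ab = (a, b)" by force
  have sep': "a \<bullet> x + b * r > d" if "g x \<le> ereal r" for x r
    using sep(2)[of "(x, r)"] that by (simp add: epi_def ab inner_prod_def)
  \<comment> \<open>The separated point lies directly below \<open>(x0, r0)\<close>, which is in
    \<open>epi\<close>; only the last coordinate differs, so \<open>b\<close> decides the
    sign.\<close>
  have "b > 0"
    using sep(1) sep'[of x0 r0] by (simp add: ab inner_prod_def r0 algebra_simps)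
  have "ereal (((- 1 / b) *\<^sub>R a) \<bullet> x - (- d / b)) \<le> g x" for x
  proof (cases "g x")
    case (real r)
    then have "a \<bullet> x + b * r > d" using sep' by simp
    then show ?thesis using \<open>b > 0\<close> real by (simp add: field_simps)
  qed (use g(1) in \<open>auto simp: proper_def\<close>)
  then show ?thesis using that by blast
qed

text \<open>A point where \<open>g\<close> is finite keeps the supremum above minus infinity
  everywhere. The slope \<open>v\<close> of an affine minorant with offset \<open>d\<close> is a
  point where the supremum is at most \<open>d\<close>.\<close>

lemma proper_conjugate:
  fixes g :: "'a :: euclidean_space \<Rightarrow> ereal"
  assumes "g \<in> \<F>"
  shows "proper (conjugate g)"
proof -
  have g: "proper g" using assms by (auto simp: closed_convex_functions_def)
  then obtain x0 where "g x0 \<noteq> \<infinity>" by (auto simp: proper_def)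
  then have "conjugate g y \<noteq> - \<infinity>" for y
    using SUP_upper[of x0 UNIV "\<lambda>x. ereal (y \<bullet> x) - g x"]
    by (cases "g x0") (use g in \<open>auto simp: conjugate_def proper_def\<close>)
  moreover obtain v d where vd: "\<And>x. ereal (v \<bullet> x - d) \<le> g x"
    using closed_convex_affine_minorant[OF assms] by blast
  have "ereal (v \<bullet> x) - g x \<le> ereal d" for x
    using vd[of x] by (cases "g x") auto
  then have "conjugate g v \<le> ereal d"
    by (auto simp: conjugate_def intro: SUP_least)
  then have "conjugate g v \<noteq> \<infinity>" by auto
  ultimately show ?thesis by (auto simp: proper_def)
qed

lemma convex_conjugate:
  assumes "proper g"
  shows "convex_ereal (conjugate g)"
  unfolding convex_ereal_def
proof (intro allI ballI)
  fix y z :: 'a and t :: real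
  assume t: "t \<in> {0<..<1}"
  have "ereal (((1 - t) *\<^sub>R y + t *\<^sub>R z) \<bullet> x) - g x
      \<le> ereal (1 - t) * conjugate g y + ereal t * conjugate g z" for x
  proof (cases "g x")
    case (real r)
    have "ereal (w \<bullet> x - r) \<le> conjugate g w" for w
      using SUP_upper[of x UNIV "\<lambda>x. ereal (w \<bullet> x) - g x"] by (simp add: conjugate_def real)
    then have "ereal (1 - t) * ereal (y \<bullet> x - r) + ereal t * ereal (z \<bullet> x - r)
        \<le> ereal (1 - t) * conjugate g y + ereal t * conjugate g z"
      using t by (intro add_mono ereal_mult_left_mono) auto
    moreover have "(1 - t) * (y \<bullet> x - r) + t * (z \<bullet> x - r) = ((1 - t) *\<^sub>R y + t *\<^sub>R z) \<bullet> x - r"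
      by (simp add: inner_add_left algebra_simps)
    ultimately show ?thesis by (simp add: real)
  qed (use assms in \<open>auto simp: proper_def\<close>)
  then show "conjugate g ((1 - t) *\<^sub>R y + t *\<^sub>R z)
      \<le> ereal (1 - t) * conjugate g y + ereal t * conjugate g z"
    unfolding conjugate_def[of g "(1 - t) *\<^sub>R y + t *\<^sub>R z"] by (intro SUP_least)
qed

section \<open>Optimality conditions and monotonicity of subdifferentials\<close>

text \<open>Fermat's rule for a proximal step, obtained without a sum rule for subdifferentials:
  \<open>p\<close> is compared with the points \<open>(1 - t) p + t z\<close> of a segment,
  convexity bounds \<open>h\<close> there, and after division by \<open>t\<close> the limit
  \<open>t -> 0\<close> removes the second-order term.\<close>

lemma proximal_subgradient:
  fixes h :: "'a :: real_inner \<Rightarrow> ereal"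
  assumes "proper h" "convex_ereal h"
    and min: "\<And>u. h p + ereal (l \<bullet> p + q * (norm (p - x))\<^sup>2) \<le> h u + ereal (l \<bullet> u + q * (norm (u - x))\<^sup>2)"
  shows "- l - (2 * q) *\<^sub>R (p - x) \<in> subdifferential h p"
proof -
  have not_minf: "h u \<noteq> - \<infinity>" for u using assms(1) by (simp add: proper_def)
  obtain u0 where "h u0 \<noteq> \<infinity>" using assms(1) by (auto simp: proper_def)
  with min[of u0] have "h p \<noteq> \<infinity>" by (cases "h u0") auto
  with not_minf[of p] obtain a where a: "h p = ereal a" by (cases "h p") auto
  have "h p + ereal ((- l - (2 * q) *\<^sub>R (p - x)) \<bullet> (z - p)) \<le> h z" for z
  proof (cases "h z")
    case (real b)
    have step: "a \<le> b + l \<bullet> (z - p) + q * (2 * ((z - p) \<bullet> (p - x)) + t * (norm (z - p))\<^sup>2)"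
      if t: "t \<in> {0<..<1}" for t
    proof -
      define u where "u = (1 - t) *\<^sub>R p + t *\<^sub>R z"
      have u: "u = p + t *\<^sub>R (z - p)" by (simp add: u_def algebra_simps)
      have nrm: "(norm (u - x))\<^sup>2 = (norm (p - x))\<^sup>2 + t * (2 * ((z - p) \<bullet> (p - x)) + t * (norm (z - p))\<^sup>2)"
        unfolding u power2_norm_eq_inner by (simp add: inner_simps inner_commute algebra_simps)
      have "h u \<le> ereal ((1 - t) * a + t * b)"
        using assms(2)[unfolded convex_ereal_def, rule_format, OF t, of p z] by (simp add: a real u_def)
      then have "h u + ereal (l \<bullet> u + q * (norm (u - x))\<^sup>2)
          \<le> ereal ((1 - t) * a + t * b) + ereal (l \<bullet> u + q * (norm (u - x))\<^sup>2)"
        by (rule add_right_mono)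
      from order_trans[OF min[of u] this]
      have "a + (l \<bullet> p + q * (norm (p - x))\<^sup>2) \<le> (1 - t) * a + t * b + (l \<bullet> u + q * (norm (u - x))\<^sup>2)"
        by (simp add: a)
      then have "t * a \<le> t * (b + l \<bullet> (z - p) + q * (2 * ((z - p) \<bullet> (p - x)) + t * (norm (z - p))\<^sup>2))"
        unfolding nrm by (simp add: u inner_simps algebra_simps)
      then show ?thesis using t by simp
    qed
    have "((\<lambda>t. b + l \<bullet> (z - p) + q * (2 * ((z - p) \<bullet> (p - x)) + t * (norm (z - p))\<^sup>2)) \<longlongrightarrow>
        b + l \<bullet> (z - p) + q * (2 * ((z - p) \<bullet> (p - x)) + 0 * (norm (z - p))\<^sup>2)) (at_right (0::real))"
      by (intro tendsto_intros)
    moreover have "\<forall>\<^sub>F t in at_right (0::real). t \<in> {0<..<1}"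
      by (rule eventually_at_right_real) simp
    then have "\<forall>\<^sub>F t in at_right (0::real).
        a \<le> b + l \<bullet> (z - p) + q * (2 * ((z - p) \<bullet> (p - x)) + t * (norm (z - p))\<^sup>2)"
      by (rule eventually_mono) (rule step)
    ultimately have "a \<le> b + l \<bullet> (z - p) + q * (2 * ((z - p) \<bullet> (p - x)) + 0 * (norm (z - p))\<^sup>2)"
      by (rule tendsto_lowerbound) simp
    then show ?thesis
      by (simp add: a real inner_simps inner_commute algebra_simps)
  qed (use not_minf in auto)
  then show ?thesis by (simp add: subdifferential_def effective_domain_def a)
qed

lemma inner_vector_matrix_mult: "u \<bullet> (w v* F) = w \<bullet> (F *v u)" for F :: "real^'n^'m"
  by (metis dot_lmul_matrix inner_commute)

lemma saddle_point_subgradients: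
  assumes "proper f" "proper (conjugate g)"
    and saddle: "saddle_point (lagrangian f g F) xs ys"
  shows "- (ys v* F) \<in> subdifferential f xs" "F *v xs \<in> subdifferential (conjugate g) ys"
proof -
  have nf: "f u \<noteq> - \<infinity>" and ng: "conjugate g v \<noteq> - \<infinity>" for u v
    using assms(1,2) by (auto simp: proper_def)
  have S: "lagrangian f g F xs v \<le> lagrangian f g F xs ys"
    "lagrangian f g F xs ys \<le> lagrangian f g F u ys" for u v
    using saddle by (auto simp: saddle_point_def)
  obtain u0 v0 where 0: "f u0 \<noteq> \<infinity>" "conjugate g v0 \<noteq> \<infinity>"
    using assms(1,2) by (auto simp: proper_def)
  \<comment> \<open>If \<open>f xs\<close> were infinite, the Lagrangian at the saddle point would
    be infinite too, by the convention for the difference of infinities even when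
    \<open>conjugate g ys\<close> is infinite; at \<open>u0\<close> it is smaller.\<close>
  have "f xs \<noteq> \<infinity>"
    using S(2)[of u0] 0(1) nf[of u0] ng[of ys]
    by (cases "f u0"; cases "conjugate g ys") (auto simp: lagrangian_def)
  then obtain a where a: "f xs = ereal a" using nf[of xs] by (cases "f xs") auto
  \<comment> \<open>Otherwise the Lagrangian would be minus infinity at \<open>(xs, ys)\<close>,
    below its finite value at \<open>(xs, v0)\<close>.\<close>
  have "conjugate g ys \<noteq> \<infinity>"
    using S(1)[of v0] 0(2) ng[of v0] a by (cases "conjugate g v0") (auto simp: lagrangian_def)
  then obtain b where b: "conjugate g ys = ereal b"
    using ng[of ys] by (cases "conjugate g ys") auto
  have "f xs + ereal (- (ys v* F) \<bullet> (u - xs)) \<le> f u" for u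
    using S(2)[of u] nf[of u] a b
    by (cases "f u") (auto simp: lagrangian_def inner_vector_matrix_mult inner_commute inner_simps)
  then show "- (ys v* F) \<in> subdifferential f xs"
    by (simp add: subdifferential_def effective_domain_def a)
  have "conjugate g ys + ereal ((F *v xs) \<bullet> (v - ys)) \<le> conjugate g v" for v
    using S(1)[of v] ng[of v] a b
    by (cases "conjugate g v") (auto simp: lagrangian_def inner_simps)
  then show "F *v xs \<in> subdifferential (conjugate g) ys"
    by (simp add: subdifferential_def effective_domain_def b)
qed

lemma subdifferential_monotone:
  assumes "\<And>x. h x \<noteq> - \<infinity>" and "v \<in> subdifferential h p" "w \<in> subdifferential h q"
  shows "0 \<le> (v - w) \<bullet> (p - q)"
proof -
  obtain a where a: "h p = ereal a"
    using assms(1)[of p] assms(2) by (cases "h p") (auto simp: subdifferential_def effective_domain_def)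
  obtain b where b: "h q = ereal b"
    using assms(1)[of q] assms(3) by (cases "h q") (auto simp: subdifferential_def effective_domain_def)
  have "h p + ereal (v \<bullet> (q - p)) \<le> h q" "h q + ereal (w \<bullet> (p - q)) \<le> h p"
    using assms(2,3) by (auto simp: subdifferential_def)
  then show ?thesis by (simp add: a b inner_simps)
qed

text \<open>Adding the two strong subgradient inequalities cancels the values of \<open>h\<close>
  and doubles the modulus \<mu>/2.\<close>

lemma subdifferential_strongly_monotone:
  assumes "h \<in> \<S> \<mu>" and "v \<in> subdifferential h p" "w \<in> subdifferential h q"
  shows "\<mu> * (norm (p - q))\<^sup>2 \<le> (v - w) \<bullet> (p - q)"
proof -
  have h: "h x \<noteq> - \<infinity>" for x
    using assms(1) by (auto simp: strongly_convex_functions_def closed_convex_functions_def proper_def)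
  obtain a where a: "h p = ereal a"
    using h[of p] assms(2) by (cases "h p") (auto simp: subdifferential_def effective_domain_def)
  obtain b where b: "h q = ereal b"
    using h[of q] assms(3) by (cases "h q") (auto simp: subdifferential_def effective_domain_def)
  have "h p + ereal (v \<bullet> (q - p) + \<mu> / 2 * (norm (q - p))\<^sup>2) \<le> h q"
    "h q + ereal (w \<bullet> (p - q) + \<mu> / 2 * (norm (p - q))\<^sup>2) \<le> h p"
    using assms by (auto simp: strongly_convex_functions_def)
  then show ?thesis by (simp add: a b inner_simps norm_minus_commute)
qed

text \<open>Each proximal step yields a subgradient at the new iterate, which is paired with the
  subgradient at the saddle point. The asymmetry is that of the algorithm: the primal step sees the
  old \<open>y k\<close>, the dual step the extrapolated point
  \<open>2 x (Suc k) - x k\<close>.\<close>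

lemma pdhg_monotone:
  fixes F :: "real^'n^'m"
  assumes f: "f \<in> \<S> \<mu>" and g: "g \<in> \<F>"
    and saddle: "saddle_point (lagrangian f g F) xs ys"
    and pdhg: "pdhg f g F \<tau> \<sigma> (\<lambda>_. 1) x y"
  shows "\<mu> * (norm (x (Suc k) - xs))\<^sup>2
    \<le> ((x k - x (Suc k)) \<bullet> (x (Suc k) - xs)) / \<tau> k - (F *v (x (Suc k) - xs)) \<bullet> (y k - ys)" (is ?X)
    and "0 \<le> ((y k - y (Suc k)) \<bullet> (y (Suc k) - ys)) / \<sigma> k
      + (F *v (2 *\<^sub>R (x (Suc k) - xs) - (x k - xs))) \<bullet> (y (Suc k) - ys)" (is ?Y)
proof -
  have f': "proper f" "convex_ereal f"
    using f by (auto simp: strongly_convex_functions_def closed_convex_functions_def)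
  have g': "proper (conjugate g)" "convex_ereal (conjugate g)"
    using g proper_conjugate convex_conjugate by (auto simp: closed_convex_functions_def)
  note sub = saddle_point_subgradients[OF f'(1) g'(1) saddle]
  have "f (x (Suc k)) + ereal ((y k v* F) \<bullet> x (Suc k) + 1 / (2 * \<tau> k) * (norm (x (Suc k) - x k))\<^sup>2)
      \<le> f u + ereal ((y k v* F) \<bullet> u + 1 / (2 * \<tau> k) * (norm (u - x k))\<^sup>2)" for u
    using pdhg f'(1)
    by (auto simp: pdhg_def is_arg_min_linorder inner_vector_matrix_mult inner_commute add.assoc)
  from subdifferential_strongly_monotone[OF f proximal_subgradient[OF f' this] sub(1)]
  show ?X
    by (simp add: inner_simps inner_vector_matrix_mult dot_lmul_matrix inner_commute
        matrix_vector_mult_diff_distrib diff_divide_distrib add_divide_distrib algebra_simps)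
  define z where "z = x (Suc k) + 1 *\<^sub>R (x (Suc k) - x k)"
  have max: "- conjugate g v + ereal ((F *v z) \<bullet> v) - ereal (1 / (2 * \<sigma> k) * (norm (v - y k))\<^sup>2)
      \<le> - conjugate g (y (Suc k)) + ereal ((F *v z) \<bullet> y (Suc k))
        - ereal (1 / (2 * \<sigma> k) * (norm (y (Suc k) - y k))\<^sup>2)" for v
    using pdhg by (auto simp: pdhg_def is_arg_max_linorder z_def Let_def)
  \<comment> \<open>Negation turns the argmax into a minimum of the proximal shape, with linear part
    \<open>- (F *v z)\<close>.\<close>
  have "conjugate g (y (Suc k)) + ereal ((- (F *v z)) \<bullet> y (Suc k) + 1 / (2 * \<sigma> k) * (norm (y (Suc k) - y k))\<^sup>2)
      \<le> conjugate g v + ereal ((- (F *v z)) \<bullet> v + 1 / (2 * \<sigma> k) * (norm (v - y k))\<^sup>2)" for v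
    using max[of v] by (cases "conjugate g v"; cases "conjugate g (y (Suc k))") auto
  from subdifferential_monotone[OF _ proximal_subgradient[OF g' this] sub(2)]
  show ?Y using g'(1)
    by (simp add: proper_def z_def inner_simps matrix_vector_mult_diff_distrib scaleR_2
        matrix_vector_right_distrib diff_divide_distrib add_divide_distrib algebra_simps)
qed

section \<open>The energy as a quadratic form and its decrease in one step\<close>

lemma abs_inner_matrix_le: "\<bar>(F *v u) \<bullet> w\<bar> \<le> op_norm F * (norm u * norm w)"
proof -
  have "\<bar>(F *v u) \<bullet> w\<bar> \<le> norm (F *v u) * norm w"
    by (rule Cauchy_Schwarz_ineq2)
  also have "\<dots> \<le> (op_norm F * norm u) * norm w"
    unfolding op_norm_def by (intro mult_right_mono onorm matrix_vector_mul_bounded_linear) auto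
  finally show ?thesis by (simp add: mult.assoc)
qed

lemma young_ineq: "a * b \<le> \<kappa> / 2 * a\<^sup>2 + b\<^sup>2 / (2 * \<kappa>)" if "\<kappa> > 0" for a b \<kappa> :: real
proof -
  have "0 \<le> (\<kappa> * a - b)\<^sup>2 / (2 * \<kappa>)" using that by simp
  also have "\<dots> = \<kappa> / 2 * a\<^sup>2 + b\<^sup>2 / (2 * \<kappa>) - a * b"
    using that by (simp add: field_simps power2_eq_square)
  finally show ?thesis by simp
qed

text \<open>With \<open>a = 1 / \<tau> k\<close> and \<open>b = 1 / \<sigma> k\<close> this is the
  energy. Free weights and arguments allow the old weights at the new iterate and at the
  increment.\<close>

definition energy_form :: "real^'n^'m \<Rightarrow> real \<Rightarrow> real \<Rightarrow> real^'n \<Rightarrow> real^'m \<Rightarrow> real" where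
  "energy_form F a b u w = a / 2 * (norm u)\<^sup>2 + b / 2 * (norm w)\<^sup>2 - (F *v u) \<bullet> w"

text \<open>Young's inequality with parameter \<open>s * a\<close> bounds the cross term by
  \<open>s * op_norm F\<close> times the diagonal part: as \<open>a * b = 1 / s^2\<close>, both
  squares receive the same factor \<open>s\<close>.\<close>

lemma energy_form_bounds:
  assumes "a > 0" "b > 0" "s > 0" "a * b = 1 / s\<^sup>2"
  shows "(1 - s * op_norm F) * (a / 2 * (norm u)\<^sup>2 + b / 2 * (norm w)\<^sup>2) \<le> energy_form F a b u w"
    and "energy_form F a b u w \<le> (1 + s * op_norm F) * (a / 2 * (norm u)\<^sup>2 + b / 2 * (norm w)\<^sup>2)"
proof -
  have b: "b = 1 / (a * s\<^sup>2)" using assms by (simp add: field_simps)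
  have "norm u * norm w \<le> (s * a) / 2 * (norm u)\<^sup>2 + (norm w)\<^sup>2 / (2 * (s * a))"
    using assms by (intro young_ineq) auto
  also have "\<dots> = s * (a / 2 * (norm u)\<^sup>2 + b / 2 * (norm w)\<^sup>2)"
    using assms(1,3) by (simp add: b field_simps power2_eq_square)
  finally have "op_norm F * (norm u * norm w) \<le> op_norm F * (s * (a / 2 * (norm u)\<^sup>2 + b / 2 * (norm w)\<^sup>2))"
    by (intro mult_left_mono) (simp_all add: op_norm_def onorm_pos_le)
  with abs_inner_matrix_le[of F u w]
  have "\<bar>(F *v u) \<bullet> w\<bar> \<le> s * op_norm F * (a / 2 * (norm u)\<^sup>2 + b / 2 * (norm w)\<^sup>2)"
    by (simp add: algebra_simps)
  then show "(1 - s * op_norm F) * (a / 2 * (norm u)\<^sup>2 + b / 2 * (norm w)\<^sup>2) \<le> energy_form F a b u w"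
    "energy_form F a b u w \<le> (1 + s * op_norm F) * (a / 2 * (norm u)\<^sup>2 + b / 2 * (norm w)\<^sup>2)"
    unfolding energy_form_def left_diff_distrib distrib_right by auto
qed

text \<open>Here \<open>n\<close> stands for \<open>k + 1\<close>; \<open>u\<close>,
  \<open>w\<close> are the errors at step \<open>k\<close> and \<open>u'\<close>, \<open>w'\<close>
  those at step \<open>k + 1\<close>.\<close>

lemma energy_form_step:
  fixes F :: "real^'n^'m"
  assumes "n > 0" "s > 0" "c > 0" "s * op_norm F \<le> 1" "\<alpha> \<ge> 0"
    and \<alpha>1: "\<alpha> * (s + c) \<le> 2 * \<mu> - c" and \<alpha>2: "\<alpha> * (1 + c * s * (op_norm F)\<^sup>2) \<le> 1"
    and X: "\<mu> * (norm u')\<^sup>2 \<le> (c * n) * ((u - u') \<bullet> u') - (F *v u') \<bullet> w"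
    and Y: "0 \<le> 1 / (c * s\<^sup>2 * n) * ((w - w') \<bullet> w') + (F *v (2 *\<^sub>R u' - u)) \<bullet> w'"
  shows "(n + 1 + \<alpha>) * energy_form F (c * (n + 1)) (1 / (c * s\<^sup>2 * (n + 1))) u' w'
    \<le> (n + 1) * energy_form F (c * n) (1 / (c * s\<^sup>2 * n)) u w"
proof -
  define b where "b = 1 / (c * s\<^sup>2 * n)"
  define L where "L = op_norm F"
  define A where "A = (norm u')\<^sup>2"
  define B where "B = (norm w')\<^sup>2"
  have AB: "A \<ge> 0" "B \<ge> 0" by (auto simp: A_def B_def)
  have "0 \<le> (1 - s * op_norm F) * (c * n / 2 * (norm (u' - u))\<^sup>2 + b / 2 * (norm (w' - w))\<^sup>2)"
    using assms by (intro mult_nonneg_nonneg add_nonneg_nonneg) (auto simp: b_def)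
  also have "\<dots> \<le> energy_form F (c * n) b (u' - u) (w' - w)"
    using assms by (intro energy_form_bounds) (auto simp: b_def field_simps)
  finally have D: "0 \<le> energy_form F (c * n) b (u' - u) (w' - w)" .
  \<comment> \<open>Three-point identity of a quadratic form. The extrapolation
    \<open>2 u' - u\<close> is what makes the coupling terms agree with those in \<open>X\<close>
    and \<open>Y\<close>.\<close>
  have "energy_form F (c * n) b u w - energy_form F (c * n) b u' w' - energy_form F (c * n) b (u' - u) (w' - w)
      = (c * n) * ((u - u') \<bullet> u') - (F *v u') \<bullet> w
        + (b * ((w - w') \<bullet> w') + (F *v (2 *\<^sub>R u' - u)) \<bullet> w')"
    unfolding energy_form_def power2_norm_eq_inner
    by (simp add: inner_simps matrix_vector_mult_diff_distrib matrix_vector_mult_scaleR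
        inner_commute field_simps)
  with D X Y have desc: "energy_form F (c * n) b u' w' + \<mu> * A \<le> energy_form F (c * n) b u w"
    by (simp add: A_def b_def)
  \<comment> \<open>The Young parameter \<open>s * (n + 1)\<close> makes the coefficients of
    \<open>A\<close> and \<open>B\<close> in the new energy proportional to \<open>s + c\<close> and
    \<open>1 + c * s * L^2\<close>, the denominators in \<alpha>.\<close>
  have "- ((F *v u') \<bullet> w') \<le> norm u' * (L * norm w')"
    using abs_inner_matrix_le[of F u' w'] by (simp add: L_def algebra_simps)
  also have "\<dots> \<le> (s * (n + 1)) / 2 * A + (L * norm w')\<^sup>2 / (2 * (s * (n + 1)))"
    unfolding A_def using assms by (intro young_ineq) auto
  finally have cross: "- ((F *v u') \<bullet> w') \<le> s * (n + 1) / 2 * A + L\<^sup>2 * B / (2 * (s * (n + 1)))"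
    by (simp add: B_def power_mult_distrib)
  define f' where "f' = energy_form F (c * (n + 1)) (1 / (c * s\<^sup>2 * (n + 1))) u' w'"
  \<comment> \<open>Passing from the weights at \<open>n\<close> to those at \<open>n + 1\<close>
    raises the primal weight by \<open>c\<close>, and \<open>(n + 1) / n - 1 = 1 / n\<close> turns
    the drop of the dual weight into exactly \<open>b / 2 * B\<close>.\<close>
  have "(n + 1) * f' = (n + 1) * energy_form F (c * n) b u' w' + (n + 1) * c / 2 * A - b / 2 * B"
    using assms(1-3) unfolding f'_def energy_form_def b_def A_def[symmetric] B_def[symmetric]
    by (simp add: divide_simps) (simp add: algebra_simps)
  also have "\<dots> \<le> (n + 1) * (energy_form F (c * n) b u w - \<mu> * A) + (n + 1) * c / 2 * A - b / 2 * B"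
    using desc assms(1) by simp
  finally have E1: "(n + 1) * f' \<le> (n + 1) * energy_form F (c * n) b u w - (n + 1) / 2 * A * (2 * \<mu> - c) - b / 2 * B"
    by (simp add: field_simps)
  have "f' \<le> c * (n + 1) / 2 * A + B / (2 * (c * s\<^sup>2 * (n + 1)))
      + (s * (n + 1) / 2 * A + L\<^sup>2 * B / (2 * (s * (n + 1))))"
    using cross by (simp add: f'_def energy_form_def A_def B_def mult.commute[of _ 2])
  also have "\<dots> = (n + 1) / 2 * A * (s + c) + B / (2 * (c * s\<^sup>2 * (n + 1))) * (1 + c * s * L\<^sup>2)"
    using assms(1-3) by (simp add: divide_simps) (simp add: algebra_simps power2_eq_square)
  finally have "\<alpha> * f' \<le> \<alpha> * ((n + 1) / 2 * A * (s + c) + B / (2 * (c * s\<^sup>2 * (n + 1))) * (1 + c * s * L\<^sup>2))"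
    using assms by (intro mult_left_mono) auto
  also have "\<dots> = (n + 1) / 2 * A * (\<alpha> * (s + c)) + B / (2 * (c * s\<^sup>2 * (n + 1))) * (\<alpha> * (1 + c * s * L\<^sup>2))"
    by (simp add: algebra_simps)
  also have "\<dots> \<le> (n + 1) / 2 * A * (2 * \<mu> - c) + B / (2 * (c * s\<^sup>2 * (n + 1))) * 1"
    using assms AB by (intro add_mono mult_left_mono \<alpha>1) (auto simp: L_def)
  also have "B / (2 * (c * s\<^sup>2 * (n + 1))) * 1 \<le> B / (2 * (c * s\<^sup>2 * n))"
    using assms AB by (simp, intro divide_left_mono) auto
  also have "B / (2 * (c * s\<^sup>2 * n)) = b / 2 * B"
    by (simp add: b_def)
  finally have "\<alpha> * f' \<le> (n + 1) / 2 * A * (2 * \<mu> - c) + b / 2 * B"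
    by simp
  with E1 show ?thesis
    by (simp add: f'_def[symmetric] b_def[symmetric] distrib_right)
qed

section \<open>Gamma function facts for the rate\<close>

text \<open>The convex function \<open>ln Gamma\<close> vanishes at 1 and 2, so it is nonpositive in
  between.\<close>

lemma Gamma_le_1: "Gamma (1 + a) \<le> 1" if "0 \<le> a" "a \<le> 1" for a :: real
proof -
  have "(ln \<circ> Gamma) ((1 - a) *\<^sub>R 1 + a *\<^sub>R 2) \<le> (1 - a) * (ln \<circ> Gamma) 1 + a * (ln \<circ> Gamma) (2::real)"
    using that by (intro convex_onD[OF log_convex_Gamma_real]) auto
  then have "ln (Gamma (1 + a)) \<le> 0"
    by (simp add: Gamma_numeral algebra_simps)
  then show ?thesis using that by simp
qed

lemma real_fact_plus_1: "real_fact (z + 1) = (z + 1) * real_fact z" if "z > - 1"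
proof -
  have "z + 1 \<notin> \<int>\<^sub>\<le>\<^sub>0"
    using that by (auto dest: nonpos_Ints_nonpos)
  then show ?thesis
    unfolding real_fact_def by (rule Gamma_plus1)
qed

section \<open>Energy decay, rate and convergence of the primal iterates\<close>

theorem theorem3p2:
  fixes f :: "real^'n \<Rightarrow> ereal" and g :: "real^'m \<Rightarrow> ereal" and F :: "real^'n^'m"
    and \<mu> s c \<alpha> :: real and \<tau> \<sigma> :: "nat \<Rightarrow> real"
    and xs :: "real^'n" and ys :: "real^'m"
    and x :: "nat \<Rightarrow> real^'n" and y :: "nat \<Rightarrow> real^'m" and E :: "nat \<Rightarrow> real"
  assumes "\<mu> > 0"
    and "f \<in> \<S> \<mu>" and "g \<in> \<F>"
    and "s > 0" and "F \<noteq> 0 \<longrightarrow> s\<^sup>2 < 1 / (op_norm F)\<^sup>2"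
    and "0 < c" and "c < 2 * \<mu>"
    and "saddle_point (lagrangian f g F) xs ys"
    and "\<And>k. \<tau> k = 1 / (c * (real k + 1))"
    and "\<And>k. \<sigma> k = c * s\<^sup>2 * (real k + 1)"
    and "pdhg f g F \<tau> \<sigma> (\<lambda>_. 1) x y"
    and "\<And>k. E k = energy F \<tau> \<sigma> xs ys x y k"
    and "\<alpha> = min ((2 * \<mu> - c) / (s + c)) (1 / (1 + c * s * (op_norm F)\<^sup>2))"
  shows "(\<forall>k. E k \<le> (1 + \<alpha>) * fact (k + 1) / real_fact (real k + 1 + \<alpha>) * E 0) \<and>
    x \<longlonglongrightarrow> xs \<and>
    (\<forall>k. (norm (x k - xs))\<^sup>2 \<le>
      (1 + s * op_norm F) / (1 - s * op_norm F) *
      ((1 + \<alpha>) * fact k / real_fact (real k + 1 + \<alpha>)) *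
      ((norm (x 0 - xs))\<^sup>2 + 1 / (c\<^sup>2 * s\<^sup>2) * (norm (y 0 - ys))\<^sup>2))"
proof -
  define L where "L = op_norm F"
  define a where "a k = c * (real k + 1)" for k
  define b where "b k = 1 / (c * s\<^sup>2 * (real k + 1))" for k
  define P where "P k = a k / 2 * (norm (x k - xs))\<^sup>2 + b k / 2 * (norm (y k - ys))\<^sup>2" for k
  define R where "R k = (1 + \<alpha>) * fact (k + 1) / real_fact (real k + 1 + \<alpha>)" for k
  have "L \<ge> 0"
    by (simp add: L_def op_norm_def onorm_pos_le)
  \<comment> \<open>For \<open>F = 0\<close> the bound on \<open>s\<close> is vacuous, but
    \<open>L = 0\<close>; otherwise \<open>op_norm F\<close> is nonzero and the quotient can be
    cleared.\<close>
  have "s * L < 1"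
  proof (cases "F = 0")
    case True
    then have "(*v) F = (\<lambda>_. 0)" by (simp add: fun_eq_iff)
    then show ?thesis by (simp add: L_def op_norm_def onorm_zero)
  next
    case False
    have "op_norm F \<noteq> 0"
      using False matrix_vector_mul_bounded_linear[of F]
      by (auto simp: op_norm_def onorm_eq_0 matrix_eq)
    then have "(s * L)\<^sup>2 < 1\<^sup>2"
      using assms(5) False by (simp add: L_def power_mult_distrib field_simps)
    then show ?thesis by (rule power2_less_imp_less) simp
  qed
  have pos: "0 < 1 + c * s * L\<^sup>2" "s + c > 0"
    using assms by (auto intro!: add_pos_nonneg)
  have \<alpha>: "\<alpha> > 0" "\<alpha> \<le> (2 * \<mu> - c) / (s + c)" "\<alpha> \<le> 1 / (1 + c * s * L\<^sup>2)"
    using assms(7) pos unfolding assms(13) L_def[symmetric] by auto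
  have \<alpha>1: "\<alpha> * (s + c) \<le> 2 * \<mu> - c" and \<alpha>2: "\<alpha> * (1 + c * s * L\<^sup>2) \<le> 1"
    using \<alpha>(2,3) pos by (simp_all add: pos_le_divide_eq)
  have "1 / (1 + c * s * L\<^sup>2) \<le> 1"
    using pos(1) assms(4,6) by (simp add: pos_divide_le_eq)
  with \<alpha>(3) have "\<alpha> \<le> 1" by linarith
  have ab: "a k > 0" "b k > 0" "a k * b k = 1 / s\<^sup>2" for k
    using assms(4,6) by (simp_all add: a_def b_def add_nonneg_pos)
  have E: "E k = energy_form F (a k) (b k) (x k - xs) (y k - ys)" for k
    by (simp add: assms(9,10,12) energy_def energy_form_def a_def b_def)
  have lower: "(1 - s * L) * P k \<le> E k" and upper: "E k \<le> (1 + s * L) * P k" for k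
    unfolding E P_def L_def by (intro energy_form_bounds assms(4) ab)+
  have "P k \<ge> 0" for k
    using ab[of k] by (simp add: P_def)
  then have "0 \<le> (1 - s * L) * P k" for k
    using \<open>s * L < 1\<close> by simp
  then have E_nonneg: "E k \<ge> 0" for k
    using lower[of k] by (rule order_trans)
  note mono = pdhg_monotone[OF assms(2,3,8,11)]
  have step: "(real k + 2 + \<alpha>) * E (Suc k) \<le> (real k + 2) * E k" for k
  proof -
    have "((real k + 1) + 1 + \<alpha>) * energy_form F (c * ((real k + 1) + 1)) (1 / (c * s\<^sup>2 * ((real k + 1) + 1)))
          (x (Suc k) - xs) (y (Suc k) - ys)
      \<le> ((real k + 1) + 1) * energy_form F (c * (real k + 1)) (1 / (c * s\<^sup>2 * (real k + 1))) (x k - xs) (y k - ys)"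
      using mono[of k] \<open>s * L < 1\<close> \<alpha>(1) \<alpha>2 assms(4,6)
      by (intro energy_form_step[OF _ _ _ _ _ \<alpha>1]) (auto simp: L_def assms(9,10) mult.commute)
    then show ?thesis
      unfolding E a_def b_def by (simp add: add_ac)
  qed
  have main: "E k \<le> R k * E 0" for k
  proof (induction k)
    case 0
    have "Gamma (1 + \<alpha>) \<le> 1"
      using \<alpha>(1) \<open>\<alpha> \<le> 1\<close> by (intro Gamma_le_1) auto
    moreover have "Gamma (1 + \<alpha>) > 0"
      using \<alpha>(1) by (intro Gamma_real_pos) auto
    moreover have "real_fact (1 + \<alpha>) = (1 + \<alpha>) * Gamma (1 + \<alpha>)"
      using \<alpha>(1) real_fact_plus_1[of \<alpha>] by (simp add: real_fact_def add_ac)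
    ultimately have "R 0 \<ge> 1"
      using \<alpha>(1) by (simp add: R_def)
    then show ?case
      using E_nonneg[of 0] mult_right_mono[of 1 "R 0" "E 0"] by simp
  next
    case (Suc k)
    \<comment> \<open>The Gamma quotient obeys the recursion of \<open>step\<close> with equality:
      \<open>k + 2\<close> comes from the factorial, \<open>k + 2 + \<alpha>\<close> from the
      functional equation of Gamma.\<close>
    have R_Suc: "R (Suc k) = (real k + 2) / (real k + 2 + \<alpha>) * R k"
    proof -
      have "real_fact (real (Suc k) + 1 + \<alpha>) = (real k + 2 + \<alpha>) * real_fact (real k + 1 + \<alpha>)"
        using \<alpha>(1) real_fact_plus_1[of "real k + 1 + \<alpha>"] by (simp add: add_ac)
      then show ?thesis by (simp add: R_def add_ac mult_ac)
    qed
    have "E (Suc k) \<le> (real k + 2) / (real k + 2 + \<alpha>) * E k"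
      using step[of k] \<alpha>(1) by (simp add: pos_le_divide_eq mult.commute)
    also have "\<dots> \<le> (real k + 2) / (real k + 2 + \<alpha>) * (R k * E 0)"
      using Suc \<alpha>(1) by (intro mult_left_mono) auto
    finally show ?case
      by (simp add: R_Suc)
  qed
  have x_le_E: "(norm (x k - xs))\<^sup>2 \<le> 2 / ((1 - s * L) * c * (real k + 1)) * E k" for k
  proof -
    have "a k / 2 * (norm (x k - xs))\<^sup>2 \<le> P k"
      using ab(2)[of k] by (simp add: P_def)
    then have "(1 - s * L) * (a k / 2 * (norm (x k - xs))\<^sup>2) \<le> (1 - s * L) * P k"
      using \<open>s * L < 1\<close> by (intro mult_left_mono) auto
    also note lower[of k]
    finally have "(norm (x k - xs))\<^sup>2 * ((1 - s * L) * c * (real k + 1)) \<le> 2 * E k"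
      by (simp add: a_def algebra_simps)
    moreover have "0 < (1 - s * L) * c * (real k + 1)"
      using \<open>s * L < 1\<close> assms(6) by simp
    ultimately show ?thesis
      by (simp add: pos_le_divide_eq)
  qed
  have rate: "(norm (x k - xs))\<^sup>2 \<le> (1 + s * L) / (1 - s * L) *
      ((1 + \<alpha>) * fact k / real_fact (real k + 1 + \<alpha>)) *
      ((norm (x 0 - xs))\<^sup>2 + 1 / (c\<^sup>2 * s\<^sup>2) * (norm (y 0 - ys))\<^sup>2)" for k
  proof -
    define N where "N = (norm (x 0 - xs))\<^sup>2 + 1 / (c\<^sup>2 * s\<^sup>2) * (norm (y 0 - ys))\<^sup>2"
    \<comment> \<open>Used with \<open>m = k + 1\<close>: the factor \<open>1 / (k + 1)\<close> from
      the primal weight turns \<open>(k + 1)!\<close> into \<open>k!\<close>, and the two factors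
      \<open>c\<close> cancel.\<close>
    have cancel: "2 / (D * c * m) * (m * q * (e * (c / 2 * N))) = e / D * q * N" if "m \<noteq> 0" for D m q e :: real
      using assms(6) that by simp
    define G where "G = real_fact (real k + 1 + \<alpha>)"
    have "G > 0"
      using \<alpha>(1) by (simp add: G_def real_fact_def Gamma_real_pos)
    then have "R k \<ge> 0"
      using \<alpha>(1) by (simp add: R_def G_def)
    then have "E k \<le> R k * ((1 + s * L) * P 0)"
      by (intro order_trans[OF main] mult_left_mono upper)
    then have "2 / ((1 - s * L) * c * (real k + 1)) * E k
      \<le> 2 / ((1 - s * L) * c * (real k + 1)) * (R k * ((1 + s * L) * P 0))"
      using \<open>s * L < 1\<close> assms(6) by (intro mult_left_mono) auto
    with x_le_E[of k] have "(norm (x k - xs))\<^sup>2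
      \<le> 2 / ((1 - s * L) * c * (real k + 1)) * (R k * ((1 + s * L) * P 0))"
      by (rule order_trans)
    also have "P 0 = c / 2 * N"
      using assms(4,6) by (simp add: N_def P_def a_def b_def field_simps power2_eq_square)
    also have "R k = (real k + 1) * ((1 + \<alpha>) * fact k / real_fact (real k + 1 + \<alpha>))"
      by (simp add: R_def add_ac)
    also have "2 / ((1 - s * L) * c * (real k + 1)) *
        ((real k + 1) * ((1 + \<alpha>) * fact k / real_fact (real k + 1 + \<alpha>)) * ((1 + s * L) * (c / 2 * N)))
      = (1 + s * L) / (1 - s * L) * ((1 + \<alpha>) * fact k / real_fact (real k + 1 + \<alpha>)) * N"
      by (rule cancel) simp
    finally show ?thesis
      unfolding N_def L_def .
  qed
  \<comment> \<open>Convergence avoids Gamma asymptotics: the energy is nonincreasing, hence bounded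
    by \<open>E 0\<close>, and \<open>x_le_E\<close> already carries the factor
    \<open>1 / (k + 1)\<close>.\<close>
  have "x \<longlonglongrightarrow> xs"
  proof -
    have "E (Suc k) \<le> E k" for k
    proof -
      have "(real k + 2) * E (Suc k) \<le> (real k + 2 + \<alpha>) * E (Suc k)"
        using E_nonneg \<alpha>(1) by (intro mult_right_mono) auto
      also note step[of k]
      finally show ?thesis by simp
    qed
    then have E_le: "E k \<le> E 0" for k
      using decseqD[OF decseq_SucI[of E], of 0 k] by simp
    define C where "C = 2 / ((1 - s * L) * c) * E 0"
    have x_le: "(norm (x k - xs))\<^sup>2 \<le> C / (real k + 1)" for k
    proof -
      have "2 / ((1 - s * L) * c * (real k + 1)) * E k \<le> 2 / ((1 - s * L) * c * (real k + 1)) * E 0"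
        using \<open>s * L < 1\<close> assms(6) E_le by (intro mult_left_mono) auto
      with x_le_E[of k] show ?thesis by (simp add: C_def)
    qed
    have "(\<lambda>k. C / (real k + 1)) \<longlonglongrightarrow> 0"
      using LIMSEQ_Suc[OF lim_const_over_n[of C]] by (simp add: add.commute)
    then have "(\<lambda>k. (norm (x k - xs))\<^sup>2) \<longlonglongrightarrow> 0"
      by (rule tendsto_sandwich[OF _ _ tendsto_const, rotated 2]) (simp_all add: x_le)
    then have "(\<lambda>k. sqrt ((norm (x k - xs))\<^sup>2)) \<longlonglongrightarrow> sqrt 0"
      by (rule tendsto_real_sqrt)
    then have "(\<lambda>k. norm (x k - xs)) \<longlonglongrightarrow> 0" by simp
    then show ?thesis
      by (simp only: tendsto_norm_zero_iff LIM_zero_iff)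
  qed
  with main rate show ?thesis
    unfolding R_def L_def by (intro conjI allI)
qed

end
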